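(* Let $\mathbb{F}$ be an algebraically closed field with $\mathrm{Char}(\mathbb{F})\neq 2$, let $p\in\mathbb{F}$ with $p\ne 0$, $p\neq 1$, and let $N$ be a feasible integer. Let $U,B,D,K$ be the matrices in $\mathrm{Mat}_{N+1}(\mathbb{F})$, with rows and columns indexed by $0,1,\ldots,N$, defined as follows. $U$ has $(i,j)$-entry $K_i(j)$, where $K_i=K_i(x;p,N)$ is the $i$th Krawtchouk polynomial. $B$ is tridiagonal with $B_{i,i-1}=c_i$ $(1\le i\le N)$, $B_{i,i}=a_i$ $(0\le i\le N)$, $B_{i,i+1}=b_i$ $(0\le i\le N-1)$, where $c_i=i(p-1)$, $b_i=(i-N)p$, $a_i=-b_i-c_i$. $D=\mathrm{diag}(0,1,\ldots,N)$. $K=\mathrm{diag}(k_0,k_1,\ldots,k_N)$ with $k_i=\binom{N}{i}\left(\frac{p}{1-p}\right)^i$. Then: (i) $U^t=U$. (ii) $B^t=KBK^{-1}$. (iii) $UD=BU$. (iv) $DU=UB^t$. (v) $(1-p)^N\,UKUK=I$.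
   Context: An integer $N$ is feasible if $N\ge 0$ when $\mathrm{Char}(\mathbb{F})=0$, and $0\le N<\mathrm{Char}(\mathbb{F})$ when $\mathrm{Char}(\mathbb{F})>0$. $M^t$ denotes the transpose of $M$. With $(\alpha)_n=\alpha(\alpha+1)\cdots(\alpha+n-1)$, $(\alpha)_0=1$, the Krawtchouk polynomials with parameters $p$ and $N$ are the polynomials in $\mathbb{F}[x]$ $$K_i(x)=K_i(x;p,N)=\sum_{n=0}^{i}\frac{(-i)_n(-x)_n}{(-N)_n\,n!}\,p^{-n},\qquad i=0,1,\ldots,N.$$ *)

theory Defs
  imports
    "HOL-Computational_Algebra.Polynomial"
    "Jordan_Normal_Form.Matrix"
begin

definition feasible :: "'a :: semiring_1 itself \<Rightarrow> int \<Rightarrow> bool" where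
  "feasible _ N \<longleftrightarrow>
     (if CHAR('a) = 0 then 0 \<le> N else 0 \<le> N \<and> N < int CHAR('a))"

(* The polynomial K_i(x; p, N); the argument -x of the last rising factorial is [:0, -1:].
   It is meaningful for i \<le> N with N feasible, where all denominators are non-zero. *)
definition krawtchouk :: "'a :: field \<Rightarrow> nat \<Rightarrow> nat \<Rightarrow> 'a poly" where
  "krawtchouk p N i =
     (\<Sum>n = 0..i. Polynomial.smult
        (pochhammer (- of_nat i) n / (pochhammer (- of_nat N) n * of_nat (fact n))
           * inverse p ^ n)
        (pochhammer [:0, -1:] n))"

definition kraw_c :: "'a :: field \<Rightarrow> nat \<Rightarrow> 'a" where
  "kraw_c p i = of_nat i * (p - 1)"

definition kraw_b :: "'a :: field \<Rightarrow> nat \<Rightarrow> nat \<Rightarrow> 'a" where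
  "kraw_b p N i = (of_nat i - of_nat N) * p"

definition kraw_a :: "'a :: field \<Rightarrow> nat \<Rightarrow> nat \<Rightarrow> 'a" where
  "kraw_a p N i = - kraw_b p N i - kraw_c p i"

definition kraw_k :: "'a :: field \<Rightarrow> nat \<Rightarrow> nat \<Rightarrow> 'a" where
  "kraw_k p N i = of_nat (N choose i) * (p / (1 - p)) ^ i"

definition U_mat :: "'a :: field \<Rightarrow> nat \<Rightarrow> 'a mat" where
  "U_mat p N = mat (N + 1) (N + 1) (\<lambda>(i, j). poly (krawtchouk p N i) (of_nat j))"

definition B_mat :: "'a :: field \<Rightarrow> nat \<Rightarrow> 'a mat" where
  "B_mat p N = mat (N + 1) (N + 1) (\<lambda>(i, j).
     if i = j + 1 then kraw_c p i
     else if i = j then kraw_a p N i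
     else if j = i + 1 then kraw_b p N i
     else 0)"

definition D_mat :: "nat \<Rightarrow> 'a :: field mat" where
  "D_mat N = mat_diag (N + 1) of_nat"

definition K_mat :: "'a :: field \<Rightarrow> nat \<Rightarrow> 'a mat" where
  "K_mat p N = mat_diag (N + 1) (kraw_k p N)"

end

theory Submission
  imports Defs
begin

text \<open>Because \<open>(-i)\<^sub>n = (-1)\<^sup>n n! (i choose n)\<close>, the entries of \<open>U\<close> are
  \<open>\<Sum>\<^sub>n (i choose n) (j choose n) / (N choose n) (-1/p)\<^sup>n\<close>, which is symmetric in \<open>i\<close> and \<open>j\<close>.
  The recurrence (iii) is a comparison of coefficients in this sum, and (iv) is its transpose.
  For (v), the homogeneous generating function
  \<open>\<Sum>\<^sub>i (N choose i) U\<^sub>i\<^sub>j x\<^sup>i y\<^sup>(\<^sup>N\<^sup>-\<^sup>i\<^sup>) = (x + y)\<^sup>(\<^sup>N\<^sup>-\<^sup>j\<^sup>) (x + y - x/p)\<^sup>j\<close>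
  applied twice turns the generating function of column \<open>j\<close> of \<open>U K U\<close> into the single monomial
  \<open>(1-p)\<^sup>(\<^sup>j\<^sup>-\<^sup>N\<^sup>) p\<^sup>(\<^sup>-\<^sup>j\<^sup>) t\<^sup>j\<close>.\<close>

section \<open>Rising factorials, factorials and binomial coefficients in the field\<close>

text \<open>The difference is formed in the ring rather than in \<open>nat\<close>, which makes the
  absorption identity valid for all \<open>i\<close> and \<open>n\<close>: for \<open>i < n\<close>
  both binomial coefficients vanish.\<close>

lemma of_nat_choose_Suc:
  "of_nat (Suc n) * of_nat (i choose Suc n) =
    (of_nat i - of_nat n) * (of_nat (i choose n) :: 'a :: comm_ring_1)"
proof (cases "n \<le> i")
  case True
  have "Suc n * (i choose Suc n) = (i - n) * (i choose n)"
    by (metis binomial_absorption binomial_absorb_comp)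
  then have "of_nat (Suc n * (i choose Suc n)) = (of_nat ((i - n) * (i choose n)) :: 'a)"
    by simp
  then show ?thesis using True by (simp only: of_nat_mult of_nat_diff)
next
  case False
  then show ?thesis by (simp add: binomial_eq_0)
qed

lemma pochhammer_minus_of_nat:
  "pochhammer (- of_nat i) n = (-1) ^ n * of_nat (fact n) * (of_nat (i choose n) :: 'a :: comm_ring_1)"
proof (induction n)
  case (Suc n)
  have "pochhammer (- of_nat i) (Suc n) =
      - ((-1) ^ n * of_nat (fact n)) * ((of_nat i - of_nat n) * (of_nat (i choose n) :: 'a))"
    by (simp add: pochhammer_Suc Suc algebra_simps)
  also have "\<dots> = - ((-1) ^ n * of_nat (fact n)) * (of_nat (Suc n) * (of_nat (i choose Suc n) :: 'a))"
    by (simp only: of_nat_choose_Suc)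
  also have "\<dots> = (-1) ^ Suc n * of_nat (fact (Suc n)) * of_nat (i choose Suc n)"
    by (simp add: algebra_simps)
  finally show ?case .
qed simp

lemma poly_pochhammer:
  "poly (pochhammer q n) x = pochhammer (poly q x) n"
  for x :: "'a :: comm_ring_1"
  by (induction n) (simp_all add: pochhammer_Suc of_nat_poly)

text \<open>The factors of \<open>fact N\<close> are 1 up to \<open>N\<close>, and the
  characteristic divides none of them. This is the only form in which feasibility is used
  later.\<close>

lemma feasible_fact_nonzero:
  assumes "feasible TYPE('a :: field) (int N)"
  shows "(of_nat (fact N) :: 'a) \<noteq> 0"
proof -
  have "(of_nat (fact n) :: 'a) \<noteq> 0" if "n \<le> N" for n
    using that
  proof (induction n)
    case (Suc n)
    have "\<not> CHAR('a) dvd Suc n"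
      using assms Suc.prems by (auto simp: feasible_def split: if_splits dest: dvd_imp_le)
    then have "(of_nat (Suc n) :: 'a) \<noteq> 0"
      by (simp only: of_nat_eq_0_iff_char_dvd not_False_eq_True)
    with Suc show ?case
      by (simp only: fact_Suc of_nat_mult of_nat_id mult_eq_0_iff) simp
  qed simp
  then show ?thesis by simp
qed

text \<open>A divisor of \<open>fact N\<close> in the naturals cannot vanish in the field, since
  \<open>fact N\<close> does not.\<close>

lemma of_nat_choose_nonzero:
  assumes "(of_nat (fact N) :: 'a :: field) \<noteq> 0" "n \<le> N"
  shows "(of_nat (N choose n) :: 'a) \<noteq> 0"
proof
  assume "(of_nat (N choose n) :: 'a) = 0"
  then have "(of_nat (fact n * fact (N - n) * (N choose n)) :: 'a) = 0"
    by simp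
  with assms show False by (simp only: binomial_fact_lemma)
qed

lemma of_nat_fact_nonzero_mono:
  assumes "(of_nat (fact N) :: 'a :: field) \<noteq> 0" "n \<le> N"
  shows "(of_nat (fact n) :: 'a) \<noteq> 0"
proof
  assume "(of_nat (fact n) :: 'a) = 0"
  then have "(of_nat (fact n * fact (N - n) * (N choose n)) :: 'a) = 0"
    by simp
  with assms show False by (simp only: binomial_fact_lemma)
qed

section \<open>Symmetric form of the Krawtchouk values\<close>

text \<open>Summing up to \<open>N\<close> instead of \<open>i\<close> makes symmetry in
  \<open>i\<close> and \<open>j\<close> visible; for \<open>i \<le> N\<close> the extra terms vanish
  with \<open>i choose n\<close>. The formula also gives a value at \<open>i = Suc N\<close>, which
  the recurrence mentions.\<close>

definition kraw_val :: "'a :: field \<Rightarrow> nat \<Rightarrow> nat \<Rightarrow> nat \<Rightarrow> 'a" where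
  "kraw_val p N i j = (\<Sum>n\<le>N. of_nat (i choose n) *
     (of_nat (j choose n) / of_nat (N choose n) * (- inverse p) ^ n))"

lemma kraw_val_commute: "kraw_val p N i j = kraw_val p N j i"
  unfolding kraw_val_def by (intro sum.cong) simp_all

text \<open>Each of the three rising factorials contributes \<open>(-1) ^ n * fact n\<close>. The
  factorials cancel, and the one sign that is left is absorbed into
  \<open>- inverse p\<close>.\<close>

lemma poly_krawtchouk:
  fixes p :: "'a :: field"
  assumes "(of_nat (fact N) :: 'a) \<noteq> 0" "i \<le> N"
  shows "poly (krawtchouk p N i) (of_nat j) = kraw_val p N i j"
proof -
  have summand: "pochhammer (- of_nat i) n / (pochhammer (- of_nat N) n * of_nat (fact n)) * inverse p ^ n
      * pochhammer (- of_nat j) n =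
      of_nat (i choose n) * (of_nat (j choose n) / of_nat (N choose n) * (- inverse p) ^ n)"
    if "n \<le> i" for n
  proof -
    have "(of_nat (fact n) :: 'a) \<noteq> 0" "(of_nat (N choose n) :: 'a) \<noteq> 0"
      using of_nat_choose_nonzero of_nat_fact_nonzero_mono assms that by (meson order_trans)+
    then show ?thesis
      unfolding pochhammer_minus_of_nat power_minus [of "inverse p"] by (simp add: field_simps)
  qed
  have "poly (krawtchouk p N i) (of_nat j) =
      (\<Sum>n\<le>i. of_nat (i choose n) * (of_nat (j choose n) / of_nat (N choose n) * (- inverse p) ^ n))"
    unfolding krawtchouk_def poly_sum poly_smult poly_pochhammer atLeast0AtMost
    by (intro sum.cong refl) (simp only: summand atMost_iff poly_pCons poly_0 mult_zero_right add_0_right add_0 mult_minus_right mult_1_right)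
  also have "\<dots> = kraw_val p N i j"
    unfolding kraw_val_def using assms(2)
    by (intro sum.mono_neutral_left) (auto simp: binomial_eq_0)
  finally show ?thesis .
qed

section \<open>Three-term recurrence\<close>

text \<open>For fixed \<open>j\<close> the value is a Newton expansion in the
  \<open>i choose n\<close> with coefficients \<open>h n\<close>. The right-hand side combines its
  forward and backward differences in \<open>i\<close>, both of which replace \<open>h n\<close> by
  \<open>h (Suc n)\<close>; a two-term recurrence for \<open>h\<close> leads back to
  \<open>h n\<close>. At \<open>i = 0\<close> the truncated \<open>i - 1\<close> is harmless,
  because \<open>kraw_c p 0 = 0\<close>.\<close>

lemma kraw_val_recurrence:
  fixes p :: "'a :: field"
  assumes fact: "(of_nat (fact N) :: 'a) \<noteq> 0" and p: "p \<noteq> 0" and j: "j \<le> N"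
  shows "of_nat j * kraw_val p N i j =
    kraw_c p i * kraw_val p N (i - 1) j + kraw_a p N i * kraw_val p N i j
      + kraw_b p N i * kraw_val p N (Suc i) j"
proof -
  define h :: "nat \<Rightarrow> 'a"
    where "h n = of_nat (j choose n) / of_nat (N choose n) * (- inverse p) ^ n" for n
  have val: "kraw_val p N i j = (\<Sum>n\<le>N. of_nat (i choose n) * h n)" for i
    unfolding kraw_val_def h_def ..
  have h_top: "h (Suc N) = 0"
    using j by (simp add: h_def binomial_eq_0)
  have step: "(of_nat N - of_nat n) * p * h (Suc n) = (of_nat n - of_nat j) * h n" if "n \<le> N" for n
  proof (cases "n = N")
    case True
    \<comment> \<open>The left factor is zero. On the right, \<open>j = N\<close> makes the factor
      zero, and \<open>j < N\<close> makes \<open>j choose N\<close> zero.\<close>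
    then show ?thesis using j by (cases "j = N") (auto simp: h_def binomial_eq_0)
  next
    case False
    define A B C D :: 'a where "A = of_nat (j choose n)" and "B = of_nat (N choose n)"
      and "C = of_nat (j choose Suc n)" and "D = of_nat (N choose Suc n)"
    have nz: "B \<noteq> 0" "D \<noteq> 0"
      unfolding B_def D_def using False that by (simp_all add: of_nat_choose_nonzero [OF fact])
    have e: "of_nat (Suc n) * C = (of_nat j - of_nat n) * A"
        "of_nat (Suc n) * D = (of_nat N - of_nat n) * B"
      unfolding A_def B_def C_def D_def by (fact of_nat_choose_Suc)+
    have "(of_nat N - of_nat n) * C * B = (of_nat (Suc n) * D) * C"
      unfolding e by (simp add: algebra_simps)
    also have "\<dots> = (of_nat (Suc n) * C) * D"
      by (simp add: algebra_simps)
    also have "\<dots> = (of_nat j - of_nat n) * A * D"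
      unfolding e ..
    finally have "(of_nat N - of_nat n) * (C / D) = (of_nat j - of_nat n) * (A / B)"
      using nz by (simp add: field_simps)
    moreover have "(of_nat N - of_nat n) * p * h (Suc n) =
        - ((of_nat N - of_nat n) * (C / D)) * (- inverse p) ^ n"
      using p by (simp add: h_def C_def D_def)
    moreover have "- ((of_nat j - of_nat n) * z) * w = (of_nat n - of_nat j) * (z * w)" for z w :: 'a
      by (simp add: algebra_simps)
    ultimately show ?thesis
      by (simp only: h_def A_def B_def)
  qed
  \<comment> \<open>Pascal's rule. The sums are extended to \<open>Suc N\<close>, at no cost since
    \<open>h (Suc N) = 0\<close>, so that the index can be shifted.\<close>
  have up: "kraw_val p N (Suc i) j - kraw_val p N i j = (\<Sum>n\<le>N. of_nat (i choose n) * h (Suc n))" for i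
  proof -
    have "kraw_val p N (Suc i) j = (\<Sum>n\<le>Suc N. of_nat (Suc i choose n) * h n)"
      by (simp add: val h_top)
    also have "\<dots> = h 0 + (\<Sum>n\<le>N. of_nat (i choose n) * h (Suc n)) + (\<Sum>n\<le>N. of_nat (i choose Suc n) * h (Suc n))"
      by (simp add: sum.atMost_Suc_shift sum.distrib algebra_simps del: sum.atMost_Suc)
    also have "h 0 + (\<Sum>n\<le>N. of_nat (i choose n) * h (Suc n)) + (\<Sum>n\<le>N. of_nat (i choose Suc n) * h (Suc n)) =
        (\<Sum>n\<le>N. of_nat (i choose n) * h (Suc n)) + (\<Sum>n\<le>Suc N. of_nat (i choose n) * h n)"
      by (simp add: sum.atMost_Suc_shift del: sum.atMost_Suc)
    finally show ?thesis by (simp add: val h_top)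
  qed
  \<comment> \<open>For \<open>i = Suc m\<close> this is \<open>up\<close> at \<open>m\<close>
    combined with the absorption of \<open>i\<close> into \<open>m choose n\<close>. For
    \<open>i = 0\<close> both sides are zero.\<close>
  have down: "of_nat i * (kraw_val p N i j - kraw_val p N (i - 1) j) =
      (\<Sum>n\<le>N. (of_nat i - of_nat n) * of_nat (i choose n) * h (Suc n))"
  proof (cases i)
    case 0
    have "(\<Sum>n\<le>N. (of_nat i - of_nat n) * of_nat (i choose n) * h (Suc n)) = 0"
      using 0 by (intro sum.neutral ballI) (metis binomial_eq_0 bot_nat_0.not_eq_extremum diff_self mult_zero_left mult_zero_right of_nat_0)
    then show ?thesis using 0 by simp
  next
    case (Suc m)
    have "of_nat i * of_nat (m choose n) = (of_nat i - of_nat n) * (of_nat (i choose n) :: 'a)" for n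
    proof -
      have "Suc m * (m choose n) = (i choose Suc n) * Suc n"
        using Suc_times_binomial_eq Suc by simp
      then have "of_nat i * of_nat (m choose n) = of_nat (Suc n) * (of_nat (i choose Suc n) :: 'a)"
        by (metis Suc mult.commute of_nat_mult)
      then show ?thesis by (simp only: of_nat_choose_Suc)
    qed
    then show ?thesis
      using Suc up [of m] by (simp only: diff_Suc_1 sum_distrib_left flip: mult.assoc)
  qed
  have "kraw_c p i * kraw_val p N (i - 1) j + kraw_a p N i * kraw_val p N i j
      + kraw_b p N i * kraw_val p N (Suc i) j =
      kraw_b p N i * (kraw_val p N (Suc i) j - kraw_val p N i j)
      - (p - 1) * (of_nat i * (kraw_val p N i j - kraw_val p N (i - 1) j))"
    by (simp add: kraw_a_def kraw_c_def algebra_simps)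
  also have "\<dots> = (\<Sum>n\<le>N. kraw_b p N i * (of_nat (i choose n) * h (Suc n))
      - (p - 1) * ((of_nat i - of_nat n) * of_nat (i choose n) * h (Suc n)))"
    unfolding up down by (simp only: sum_distrib_left sum_subtractf)
  also have "\<dots> = (\<Sum>n\<le>N. (of_nat j - of_nat n) * of_nat (i choose n) * h n
      + of_nat (Suc n) * of_nat (i choose Suc n) * h (Suc n))"
  proof (intro sum.cong refl)
    fix n assume "n \<in> {..N}"
    then have e: "(of_nat N - of_nat n) * p * h (Suc n) = (of_nat n - of_nat j) * h n"
      by (simp add: step)
    \<comment> \<open>The coefficients combine by
      \<open>(i - N) * p - (p - 1) * (i - n) = (i - n) - (N - n) * p\<close>; the last product is
      the one that \<open>step\<close> rewrites.\<close>
    have "kraw_b p N i * (of_nat (i choose n) * h (Suc n))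
        - (p - 1) * ((of_nat i - of_nat n) * of_nat (i choose n) * h (Suc n)) =
        (of_nat i - of_nat n) * of_nat (i choose n) * h (Suc n)
        - of_nat (i choose n) * ((of_nat N - of_nat n) * p * h (Suc n))"
      by (simp add: kraw_b_def algebra_simps)
    also have "\<dots> = (of_nat j - of_nat n) * of_nat (i choose n) * h n
        + of_nat (Suc n) * of_nat (i choose Suc n) * h (Suc n)"
      unfolding of_nat_choose_Suc e by (simp add: algebra_simps)
    finally show "kraw_b p N i * (of_nat (i choose n) * h (Suc n))
        - (p - 1) * ((of_nat i - of_nat n) * of_nat (i choose n) * h (Suc n)) =
        (of_nat j - of_nat n) * of_nat (i choose n) * h n
        + of_nat (Suc n) * of_nat (i choose Suc n) * h (Suc n)" .
  qed
  \<comment> \<open>After the index shift the coefficients \<open>j - n\<close> and \<open>n\<close>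
    add up to \<open>j\<close>.\<close>
  also have "\<dots> = (\<Sum>n\<le>N. (of_nat j - of_nat n) * of_nat (i choose n) * h n)
      + (\<Sum>n\<le>Suc N. of_nat n * of_nat (i choose n) * h n)"
    by (simp add: sum.distrib sum.atMost_Suc_shift del: sum.atMost_Suc of_nat_Suc)
  also have "\<dots> = of_nat j * kraw_val p N i j"
    by (simp add: h_top val sum_distrib_left algebra_simps flip: sum.distrib)
  finally show ?thesis ..
qed

section \<open>Generating function of a column of \<open>U\<close>\<close>

text \<open>Trinomial revision: the weight \<open>N choose i\<close> clears the denominator
  \<open>N choose n\<close> of \<open>kraw_val\<close>.\<close>

lemma of_nat_choose_mult:
  assumes "(of_nat (fact N) :: 'a :: field) \<noteq> 0" "n \<le> i" "i \<le> N"
  shows "of_nat (N choose i) * of_nat (i choose n) / of_nat (N choose n) =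
    (of_nat ((N - n) choose (i - n)) :: 'a)"
proof -
  have "(of_nat (N choose n) :: 'a) \<noteq> 0"
    using of_nat_choose_nonzero assms by (meson order_trans)
  moreover have "of_nat (N choose i) * of_nat (i choose n) =
      (of_nat (N choose n) * of_nat ((N - n) choose (i - n)) :: 'a)"
    using choose_mult [OF assms(2,3)] by (metis of_nat_mult)
  ultimately show ?thesis by simp
qed

lemma binomial_ring_shift:
  fixes x y :: "'a :: comm_ring_1"
  assumes "n \<le> N"
  shows "(\<Sum>i=n..N. of_nat ((N - n) choose (i - n)) * (x ^ i * y ^ (N - i))) = x ^ n * (x + y) ^ (N - n)"
proof -
  have "(\<Sum>i=n..N. of_nat ((N - n) choose (i - n)) * (x ^ i * y ^ (N - i))) =
      (\<Sum>k\<le>N - n. of_nat ((N - n) choose k) * (x ^ (n + k) * y ^ (N - n - k)))"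
    using assms
    by (intro sum.reindex_bij_witness [of _ "\<lambda>k. n + k" "\<lambda>i. i - n"]) auto
  also have "\<dots> = x ^ n * (x + y) ^ (N - n)"
    unfolding binomial_ring by (simp add: sum_distrib_left power_add mult_ac)
  finally show ?thesis .
qed

lemma sum_triangle_swap:
  fixes f :: "nat \<Rightarrow> nat \<Rightarrow> 'a :: comm_monoid_add"
  shows "(\<Sum>i\<le>N. \<Sum>n\<le>i. f i n) = (\<Sum>n\<le>N. \<Sum>i=n..N. f i n)"
  by (induction N) (simp_all add: sum.distrib add.assoc)

lemma smult_sum_right:
  "Polynomial.smult c (\<Sum>i\<in>A. f i) = (\<Sum>i\<in>A. Polynomial.smult c (f i))"
  by (induction A rule: infinite_finite_induct) (simp_all add: smult_add_right)

text \<open>Once the weight has cleared the denominators, the sum over \<open>i\<close> for fixed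
  \<open>n\<close> is a shifted binomial expansion with value
  \<open>x ^ n * (x + y) ^ (N - n)\<close>. The sum over \<open>n\<close> is then a binomial
  expansion with exponent \<open>j\<close>. Arbitrary polynomials \<open>x\<close> and
  \<open>y\<close> are allowed so that the result of one application can be fed into
  another.\<close>

lemma kraw_val_generating_function:
  fixes p :: "'a :: field" and x y :: "'a poly"
  assumes fact: "(of_nat (fact N) :: 'a) \<noteq> 0" and j: "j \<le> N"
  shows "(\<Sum>i\<le>N. Polynomial.smult (of_nat (N choose i) * kraw_val p N i j) (x ^ i * y ^ (N - i))) =
    (x + y) ^ (N - j) * (x + y - Polynomial.smult (inverse p) x) ^ j"
proof -
  define q where "q = - inverse p"
  have coef: "of_nat (N choose i) * kraw_val p N i j =
      (\<Sum>n\<le>i. of_nat (j choose n) * q ^ n * of_nat ((N - n) choose (i - n)))" if "i \<le> N" for i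
  proof -
    have "of_nat (N choose i) * kraw_val p N i j =
        (\<Sum>n\<le>N. of_nat (j choose n) * q ^ n * (of_nat (N choose i) * of_nat (i choose n) / of_nat (N choose n)))"
      by (simp add: kraw_val_def q_def sum_distrib_left mult_ac)
    also have "\<dots> = (\<Sum>n\<le>i. of_nat (j choose n) * q ^ n * (of_nat (N choose i) * of_nat (i choose n) / of_nat (N choose n)))"
      using that by (intro sum.mono_neutral_right) (auto simp: binomial_eq_0)
    also have "\<dots> = (\<Sum>n\<le>i. of_nat (j choose n) * q ^ n * of_nat ((N - n) choose (i - n)))"
      using that by (intro sum.cong refl) (simp only: of_nat_choose_mult [OF fact] atMost_iff)
    finally show ?thesis .
  qed
  have "(\<Sum>i\<le>N. Polynomial.smult (of_nat (N choose i) * kraw_val p N i j) (x ^ i * y ^ (N - i))) =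
      (\<Sum>i\<le>N. \<Sum>n\<le>i. Polynomial.smult (of_nat (j choose n) * q ^ n)
        (of_nat ((N - n) choose (i - n)) * (x ^ i * y ^ (N - i))))"
    by (intro sum.cong refl) (simp add: coef smult_sum of_nat_poly)
  also have "\<dots> = (\<Sum>n\<le>N. \<Sum>i=n..N. Polynomial.smult (of_nat (j choose n) * q ^ n)
        (of_nat ((N - n) choose (i - n)) * (x ^ i * y ^ (N - i))))"
    by (rule sum_triangle_swap)
  also have "\<dots> = (\<Sum>n\<le>N. Polynomial.smult (of_nat (j choose n) * q ^ n) (x ^ n * (x + y) ^ (N - n)))"
    by (intro sum.cong refl) (simp add: binomial_ring_shift flip: smult_sum_right)
  \<comment> \<open>Terms with \<open>n > j\<close> vanish with \<open>j choose n\<close>; in the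
    others \<open>(x + y) ^ (N - j)\<close> can be split off.\<close>
  also have "\<dots> = (\<Sum>n\<le>j. Polynomial.smult (of_nat (j choose n) * q ^ n) (x ^ n * (x + y) ^ (N - n)))"
    using j by (intro sum.mono_neutral_right) (auto simp: binomial_eq_0)
  also have "\<dots> = (\<Sum>n\<le>j. (x + y) ^ (N - j) *
      (of_nat (j choose n) * (Polynomial.smult q x) ^ n * (x + y) ^ (j - n)))"
  proof (intro sum.cong refl)
    fix n assume "n \<in> {..j}"
    then have "(x + y) ^ (N - n) = (x + y) ^ (N - j) * (x + y) ^ (j - n)"
      using j by (simp flip: power_add)
    then show "Polynomial.smult (of_nat (j choose n) * q ^ n) (x ^ n * (x + y) ^ (N - n)) =
        (x + y) ^ (N - j) * (of_nat (j choose n) * (Polynomial.smult q x) ^ n * (x + y) ^ (j - n))"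
      by (simp add: smult_power of_nat_poly mult_ac)
  qed
  also have "\<dots> = (x + y) ^ (N - j) * (Polynomial.smult q x + (x + y)) ^ j"
    unfolding binomial_ring by (simp add: sum_distrib_left)
  finally show ?thesis by (simp add: q_def algebra_simps)
qed

section \<open>Orthogonality\<close>

lemma kraw_val_orthogonality:
  fixes p :: "'a :: field"
  assumes fact: "(of_nat (fact N) :: 'a) \<noteq> 0" and p: "p \<noteq> 0" "p \<noteq> 1" and i: "i \<le> N" and j: "j \<le> N"
  shows "(1 - p) ^ N * (\<Sum>l\<le>N. kraw_val p N i l * kraw_k p N l * kraw_val p N l j) * kraw_k p N j =
    (if i = j then 1 else 0)"
proof -
  define t :: "'a poly" where "t = [:0, 1:]"
  \<comment> \<open>Since \<open>kraw_k p N l\<close> is \<open>N choose l\<close> times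
    \<open>r ^ l\<close>, the matrix \<open>K\<close> supplies the weight for the second use of the
    generating function, and \<open>r\<close> scales its first argument.\<close>
  define r where "r = p / (1 - p)"
  define S where "S i = (\<Sum>l\<le>N. kraw_val p N i l * kraw_k p N l * kraw_val p N l j)" for i
  define x where "x = t + 1 - Polynomial.smult (inverse p) t"
  have t_pow: "Polynomial.smult c (t ^ n) = Polynomial.monom c n" for c n
    by (simp add: t_def monom_altdef)
  have "(\<Sum>i\<le>N. Polynomial.monom (of_nat (N choose i) * S i) i) =
      (\<Sum>i\<le>N. \<Sum>l\<le>N. Polynomial.smult (kraw_k p N l * kraw_val p N l j)
        (Polynomial.smult (of_nat (N choose i) * kraw_val p N i l) (t ^ i * 1 ^ (N - i))))"
    by (intro sum.cong refl)
      (simp add: S_def sum_distrib_left smult_sum mult_ac flip: t_pow)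
  also have "\<dots> = (\<Sum>l\<le>N. Polynomial.smult (kraw_k p N l * kraw_val p N l j)
      (\<Sum>i\<le>N. Polynomial.smult (of_nat (N choose i) * kraw_val p N i l) (t ^ i * 1 ^ (N - i))))"
    by (subst sum.swap) (simp only: smult_sum_right)
  also have "\<dots> = (\<Sum>l\<le>N. Polynomial.smult (kraw_k p N l * kraw_val p N l j) ((t + 1) ^ (N - l) * x ^ l))"
    by (intro sum.cong refl) (simp only: kraw_val_generating_function [OF fact] atMost_iff x_def)
  also have "\<dots> = (\<Sum>l\<le>N. Polynomial.smult (of_nat (N choose l) * kraw_val p N l j)
      ((Polynomial.smult r x) ^ l * (t + 1) ^ (N - l)))"
    by (simp add: kraw_k_def r_def smult_power mult_ac)
  also have "\<dots> = (Polynomial.smult r x + (t + 1)) ^ (N - j) *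
      (Polynomial.smult r x + (t + 1) - Polynomial.smult (inverse p) (Polynomial.smult r x)) ^ j"
    by (rule kraw_val_generating_function [OF fact j])
  \<comment> \<open>From \<open>r * (1 - inverse p) = -1\<close> it follows that
    \<open>smult r x\<close> is \<open>r - t\<close>. So \<open>t\<close> cancels here and leaves
    \<open>r + 1 = inverse (1 - p)\<close>; in the next equation the constants cancel instead,
    because \<open>r / p = inverse (1 - p)\<close>.\<close>
  also have "Polynomial.smult r x + (t + 1) = [:inverse (1 - p):]"
    using p by (simp add: x_def t_def r_def one_pCons field_simps)
  also have "[:inverse (1 - p):] - Polynomial.smult (inverse p) (Polynomial.smult r x) =
      Polynomial.smult (inverse p) t"
    using p by (simp add: x_def t_def r_def one_pCons field_simps)
  also have "[:inverse (1 - p):] ^ (N - j) * (Polynomial.smult (inverse p) t) ^ j =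
      Polynomial.monom (inverse (1 - p) ^ (N - j) * inverse p ^ j) j"
    by (simp add: poly_const_pow smult_power mult.commute flip: t_pow)
  finally have "Polynomial.coeff (\<Sum>i\<le>N. Polynomial.monom (of_nat (N choose i) * S i) i) i =
      Polynomial.coeff (Polynomial.monom (inverse (1 - p) ^ (N - j) * inverse p ^ j) j) i"
    by simp
  then have S: "of_nat (N choose i) * S i = (if i = j then inverse (1 - p) ^ (N - j) * inverse p ^ j else 0)"
    using i by (simp add: coeff_sum eq_commute)
  show ?thesis
  proof (cases "i = j")
    case True
    have "(1 - p) ^ N = (1 - p) ^ (N - j) * (1 - p) ^ j"
      using j by (simp flip: power_add)
    \<comment> \<open>The factor \<open>kraw_k p N j\<close> supplies the weight
      \<open>N choose i\<close> on the diagonal; its power of \<open>p / (1 - p)\<close> and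
      \<open>(1 - p) ^ N\<close> cancel the coefficient found in \<open>S\<close>.\<close>
    moreover have "(1 - p) ^ N * S i * kraw_k p N j = (1 - p) ^ N * (of_nat (N choose i) * S i) * (p / (1 - p)) ^ j"
      using True by (simp add: kraw_k_def)
    ultimately show ?thesis
      using p True unfolding S S_def [symmetric] by (simp add: field_simps)
  next
    case False
    then have "S i = 0"
      using S of_nat_choose_nonzero [OF fact i] by simp
    with False show ?thesis by (simp add: S_def)
  qed
qed

section \<open>Conjugation of \<open>B\<close> to its transpose\<close>

text \<open>These are the entries of \<open>K B\<close> at \<open>(i + 1, i)\<close> and
  \<open>(i, i + 1)\<close>, so their equality makes \<open>K B\<close> symmetric. It rests on
  absorption and on \<open>p / (1 - p) * (p - 1) = - p\<close>.\<close>

lemma kraw_k_detailed_balance: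
  assumes "p \<noteq> 1"
  shows "kraw_k p N (Suc i) * kraw_c p (Suc i) = kraw_k p N i * kraw_b p N i"
proof -
  have r: "p / (1 - p) * (p - 1) = - p"
    using assms by (simp add: field_simps)
  have "kraw_k p N (Suc i) * kraw_c p (Suc i) =
      (of_nat (Suc i) * of_nat (N choose Suc i)) * ((p / (1 - p)) ^ i * (p / (1 - p) * (p - 1)))"
    by (simp only: kraw_k_def kraw_c_def power_Suc mult_ac)
  also have "\<dots> = kraw_k p N i * kraw_b p N i"
    unfolding of_nat_choose_Suc r by (simp add: kraw_k_def kraw_b_def algebra_simps)
  finally show ?thesis .
qed

text \<open>The diagonal entries of \<open>K\<close> are nonzero, so \<open>K\<close> is inverted
  entrywise. What remains is the symmetry of \<open>K B\<close>.\<close>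

lemma B_mat_transpose_conj:
  fixes p :: "'a :: field"
  assumes fact: "(of_nat (fact N) :: 'a) \<noteq> 0" and p: "p \<noteq> 0" "p \<noteq> 1"
  shows "\<exists>Kinv. inverts_mat (K_mat p N) Kinv \<and> inverts_mat Kinv (K_mat p N) \<and>
       transpose_mat (B_mat p N) = K_mat p N * B_mat p N * Kinv"
proof (intro exI conjI)
  have k: "kraw_k p N i \<noteq> 0" if "i \<le> N" for i
    using of_nat_choose_nonzero [OF fact that] p by (simp add: kraw_k_def)
  let ?Kinv = "mat_diag (N + 1) (\<lambda>i. inverse (kraw_k p N i))"
  show "inverts_mat (K_mat p N) ?Kinv" "inverts_mat ?Kinv (K_mat p N)"
    unfolding inverts_mat_def K_mat_def mat_diag_diag using k
    by (auto simp: mat_diag_def intro!: eq_matI)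
  have B: "B_mat p N \<in> carrier_mat (N + 1) (N + 1)"
    by (simp add: B_mat_def)
  have KB: "K_mat p N * B_mat p N = mat (N + 1) (N + 1) (\<lambda>(i, j). kraw_k p N i * B_mat p N $$ (i, j))"
    unfolding K_mat_def by (rule mat_diag_mult_left [OF B])
  have KBK: "K_mat p N * B_mat p N * ?Kinv =
      mat (N + 1) (N + 1) (\<lambda>(i, j). (K_mat p N * B_mat p N) $$ (i, j) * inverse (kraw_k p N j))"
    by (rule mat_diag_mult_right) (simp add: KB)
  show "transpose_mat (B_mat p N) = K_mat p N * B_mat p N * ?Kinv"
  proof (rule eq_matI)
    fix i j
    assume "i < dim_row (K_mat p N * B_mat p N * ?Kinv)" "j < dim_col (K_mat p N * B_mat p N * ?Kinv)"
    then have ij: "i < N + 1" "j < N + 1"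
      unfolding KBK by simp_all
    \<comment> \<open>Detailed balance at \<open>i\<close> covers the case \<open>j = i + 1\<close>,
      and at \<open>j\<close> the case \<open>i = j + 1\<close>.\<close>
    have "B_mat p N $$ (j, i) * kraw_k p N j = kraw_k p N i * B_mat p N $$ (i, j)"
      using ij kraw_k_detailed_balance [OF p(2), of N i] kraw_k_detailed_balance [OF p(2), of N j]
      by (auto simp: B_mat_def mult.commute)
    with k [of j] ij show "transpose_mat (B_mat p N) $$ (i, j) = (K_mat p N * B_mat p N * ?Kinv) $$ (i, j)"
      unfolding KBK unfolding KB using B by (simp add: field_simps)
  qed (simp_all add: K_mat_def B_mat_def mat_diag_def)
qed

section \<open>Matrix identities\<close>

lemma U_mat_eq:
  assumes "(of_nat (fact N) :: 'a :: field) \<noteq> 0"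
  shows "U_mat p N = mat (N + 1) (N + 1) (\<lambda>(i, j). kraw_val (p :: 'a) N i j)"
  unfolding U_mat_def using assms by (intro eq_matI) (auto simp: poly_krawtchouk)

lemma U_mat_transpose:
  assumes "(of_nat (fact N) :: 'a :: field) \<noteq> 0"
  shows "transpose_mat (U_mat p N) = U_mat (p :: 'a) N"
  unfolding U_mat_eq [OF assms] by (intro eq_matI) (auto intro: kraw_val_commute)

text \<open>Only \<open>l = i - 1\<close>, \<open>l = i\<close> and \<open>l = i + 1\<close>
  contribute. At the borders \<open>i = 0\<close> and \<open>i = N\<close> one neighbour is missing,
  and \<open>f 0 = 0\<close> and \<open>h N = 0\<close> remove its term on the right.\<close>

lemma sum_tridiagonal:
  fixes f g h u :: "nat \<Rightarrow> 'a :: comm_ring_1"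
  assumes "i \<le> N" "f 0 = 0" "h N = 0"
  shows "(\<Sum>l<N + 1. (if i = l + 1 then f i else if i = l then g i else if l = i + 1 then h i else 0) * u l) =
    f i * u (i - 1) + g i * u i + h i * u (Suc i)"
proof -
  have "(\<Sum>l<N + 1. (if i = l + 1 then f i else if i = l then g i else if l = i + 1 then h i else 0) * u l) =
      (\<Sum>l<N + 1. (if l = i - 1 then f i * u l else 0) + (if l = i then g i * u l else 0)
        + (if l = Suc i then h i * u l else 0))"
    using assms by (intro sum.cong refl) (cases i; auto)
  also have "\<dots> = f i * u (i - 1) + g i * u i + h i * u (Suc i)"
    using assms by (cases "i = N") (auto simp: sum.distrib)
  finally show ?thesis .
qed

text \<open>By the recurrence, column \<open>j\<close> of \<open>U\<close> is an eigenvector of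
  \<open>B\<close> for the eigenvalue \<open>j\<close>.\<close>

lemma U_mat_D_mat:
  fixes p :: "'a :: field"
  assumes fact: "(of_nat (fact N) :: 'a) \<noteq> 0" and p: "p \<noteq> 0"
  shows "U_mat p N * D_mat N = B_mat p N * U_mat p N"
proof -
  have U: "U_mat p N \<in> carrier_mat (N + 1) (N + 1)"
    by (simp add: U_mat_def)
  have UD: "U_mat p N * D_mat N = mat (N + 1) (N + 1) (\<lambda>(i, j). U_mat p N $$ (i, j) * of_nat j)"
    unfolding D_mat_def by (rule mat_diag_mult_right [OF U])
  show ?thesis
  proof (rule eq_matI)
    fix i j
    assume "i < dim_row (B_mat p N * U_mat p N)" "j < dim_col (B_mat p N * U_mat p N)"
    then have ij: "i < N + 1" "j < N + 1"
      by (simp_all add: B_mat_def U_mat_def)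
    have "(B_mat p N * U_mat p N) $$ (i, j) =
        (\<Sum>l<N + 1. (if i = l + 1 then kraw_c p i else if i = l then kraw_a p N i
          else if l = i + 1 then kraw_b p N i else 0) * kraw_val p N l j)"
      using ij by (simp add: U_mat_eq [OF fact] B_mat_def scalar_prod_def atLeast0LessThan del: sum.lessThan_Suc)
    also have "\<dots> = of_nat j * kraw_val p N i j"
      using ij by (subst sum_tridiagonal)
        (simp_all add: kraw_val_recurrence [OF fact p] kraw_c_def kraw_b_def)
    finally show "(U_mat p N * D_mat N) $$ (i, j) = (B_mat p N * U_mat p N) $$ (i, j)"
      unfolding UD using ij by (simp add: U_mat_eq [OF fact] mult.commute)
  qed (simp_all add: B_mat_def U_mat_def D_mat_def mat_diag_def)
qed

lemma D_mat_U_mat: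
  fixes p :: "'a :: field"
  assumes fact: "(of_nat (fact N) :: 'a) \<noteq> 0" and p: "p \<noteq> 0"
  shows "D_mat N * U_mat p N = U_mat p N * transpose_mat (B_mat p N)"
proof -
  have c: "U_mat p N \<in> carrier_mat (N + 1) (N + 1)" "B_mat p N \<in> carrier_mat (N + 1) (N + 1)"
      "(D_mat N :: 'a mat) \<in> carrier_mat (N + 1) (N + 1)"
    by (simp_all add: U_mat_def B_mat_def D_mat_def)
  have D: "transpose_mat (D_mat N) = (D_mat N :: 'a mat)"
    by (auto simp: D_mat_def mat_diag_def intro!: eq_matI)
  have "transpose_mat (U_mat p N * D_mat N) = transpose_mat (B_mat p N * U_mat p N)"
    by (simp only: U_mat_D_mat [OF fact p])
  then show ?thesis
    by (simp only: transpose_mult [OF c(1,3)] transpose_mult [OF c(2,1)] D U_mat_transpose [OF fact])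
qed

lemma U_mat_K_mat_involution:
  fixes p :: "'a :: field"
  assumes fact: "(of_nat (fact N) :: 'a) \<noteq> 0" and p: "p \<noteq> 0" "p \<noteq> 1"
  shows "(1 - p) ^ N \<cdot>\<^sub>m (U_mat p N * K_mat p N * U_mat p N * K_mat p N) = 1\<^sub>m (N + 1)"
proof -
  have U: "U_mat p N \<in> carrier_mat (N + 1) (N + 1)"
    by (simp add: U_mat_def)
  have UK: "U_mat p N * K_mat p N = mat (N + 1) (N + 1) (\<lambda>(i, j). U_mat p N $$ (i, j) * kraw_k p N j)"
    unfolding K_mat_def by (rule mat_diag_mult_right [OF U])
  have UKUK: "U_mat p N * K_mat p N * U_mat p N * K_mat p N =
      mat (N + 1) (N + 1) (\<lambda>(i, j). (U_mat p N * K_mat p N * U_mat p N) $$ (i, j) * kraw_k p N j)"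
    unfolding K_mat_def by (rule mat_diag_mult_right) (meson U mat_diag_dim mult_carrier_mat)
  show ?thesis
  proof (rule eq_matI)
    fix i j
    assume "i < dim_row (1\<^sub>m (N + 1) :: 'a mat)" "j < dim_col (1\<^sub>m (N + 1) :: 'a mat)"
    then have ij: "i < N + 1" "j < N + 1"
      by simp_all
    have "(U_mat p N * K_mat p N * U_mat p N) $$ (i, j) =
        (\<Sum>l\<le>N. kraw_val p N i l * kraw_k p N l * kraw_val p N l j)"
      unfolding UK using ij
      by (simp add: U_mat_eq [OF fact] scalar_prod_def atLeast0LessThan lessThan_Suc_atMost del: sum.lessThan_Suc)
    then show "((1 - p) ^ N \<cdot>\<^sub>m (U_mat p N * K_mat p N * U_mat p N * K_mat p N)) $$ (i, j) =
        1\<^sub>m (N + 1) $$ (i, j)"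
      using ij kraw_val_orthogonality [OF fact p, of i j] unfolding UKUK by (simp add: mult.assoc)
  qed (simp_all add: UKUK)
qed

theorem theorem4p3:
  fixes p :: "'a :: alg_closed_field" and N :: nat
  assumes "CHAR('a) \<noteq> 2"
    and "p \<noteq> 0" and "p \<noteq> 1"
    and "feasible TYPE('a) (int N)"
  shows "transpose_mat (U_mat p N) = U_mat p N \<and>
    (\<exists>Kinv. inverts_mat (K_mat p N) Kinv \<and> inverts_mat Kinv (K_mat p N) \<and>
       transpose_mat (B_mat p N) = K_mat p N * B_mat p N * Kinv) \<and>
    U_mat p N * D_mat N = B_mat p N * U_mat p N \<and>
    D_mat N * U_mat p N = U_mat p N * transpose_mat (B_mat p N) \<and>
    (1 - p) ^ N \<cdot>\<^sub>m (U_mat p N * K_mat p N * U_mat p N * K_mat p N) = 1\<^sub>m (N + 1)"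
proof -
  note fact = feasible_fact_nonzero [OF assms(4)]
  show ?thesis
    using U_mat_transpose [OF fact] B_mat_transpose_conj [OF fact assms(2,3)]
      U_mat_D_mat [OF fact assms(2)] D_mat_U_mat [OF fact assms(2)]
      U_mat_K_mat_involution [OF fact assms(2,3)]
    by blast
qed

end
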